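(* Let $\mathcal G$ be a graph on $n$ vertices, and let $C_1,\dots,C_k$ be its true-twin equivalence classes, with $n_j=|C_j|$ (so $n_1+\cdots+n_k=n$). Then $$\mathcal A_{\mathcal S_{\mathcal G}}=\bigoplus_{j=1}^kM_{n_j},$$ where the block $M_{n_j}$ corresponds to the class $C_j$, i.e. it is the full matrix algebra $\operatorname{span}\{\varepsilon_{xy}: x,y\in C_j\}$. Moreover, any irreducibly acting operator system $\mathcal S\subseteq M_n$ whose multiplier algebra $\mathcal A_{\mathcal S}\subseteq M_n$ admits such a decomposition, $\mathcal A_{\mathcal S}=\bigoplus_{j=1}^kM_{n_j}$ with $n_1+\cdots+n_k=n$ (as a block-diagonal subalgebra of $M_n$ with respect to the standard basis), is necessarily a graph operator system, i.e. $\mathcal S=\mathcal S_{\mathcal H}$ for some graph $\mathcal H$ on $n$ vertices.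
   Context: All graphs are finite, simple and undirected; the vertex set of a graph on $n$ vertices is identified with $\{1,\dots,n\}$. Write $x\simeq_{\mathcal G}y$ if $x=y$ or $x$ is adjacent to $y$ in $\mathcal G$. With $\varepsilon_{xy}$ the matrix units of $M_n$, the graph operator system is $\mathcal S_{\mathcal G}=\operatorname{span}\{\varepsilon_{xy}: x\simeq_{\mathcal G}y\}\subseteq M_n$. Vertices $x,y$ are true twins if they have the same closed neighborhood $\mathcal N(x)=\{z: x\simeq_{\mathcal G}z\}$; this is an equivalence relation on the vertices, whose classes are the true-twin equivalence classes. An operator system in $M_n$ is a selfadjoint subspace containing the identity. It acts irreducibly on $\mathbb C^n$ if there is no non-trivial subspace $L\subseteq\mathbb C^n$ reducing $\mathcal S$ such that the restriction map $s\mapsto s|_L$, $\mathcal S\to\mathcal B(L)$, is completely isometric. In that case (and in particular for graph operator systems) the C*-envelope of $\mathcal S$ is the C*-algebra $\mathrm C^*(\mathcal S)\subseteq M_n$ generated by $\mathcal S$, and the multiplier algebra is realised concretely as $\mathcal A_{\mathcal S}=\{a\in\mathrm C^*(\mathcal S): a\mathcal S\subseteq\mathcal S,\ a^*\mathcal S\subseteq\mathcal S\}\subseteq M_n$. *)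

theory Defs
  imports "HOL-Analysis.Analysis" "HOL-Library.Disjoint_Sets"
begin

text \<open>
  The algebra \<open>M_n\<close> is the type \<open>complex^'n^'n\<close>, with the finite type \<open>'n\<close> as index (and vertex) set;
  the product is \<open>**\<close>.  The library's \<open>*\<^sub>R\<close> and \<open>span\<close> on this type are real-linear, so the
  complex vector space structure is introduced explicitly.
\<close>

definition cscale :: "complex \<Rightarrow> complex^'n^'n \<Rightarrow> complex^'n^'n" where
  "cscale c A = (\<chi> i j. c * A $ i $ j)"

interpretation cmat: vector_space "cscale :: complex \<Rightarrow> complex^'n^'n \<Rightarrow> complex^'n^'n"
  by unfold_locales (simp_all add: cscale_def vec_eq_iff algebra_simps)

definition cadjoint :: "complex^'n^'n \<Rightarrow> complex^'n^'n" where
  "cadjoint A = (\<chi> i j. cnj (A $ j $ i))"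

definition matrix_unit :: "'n \<Rightarrow> 'n \<Rightarrow> complex^'n^'n" where
  "matrix_unit x y = (\<chi> i j. if i = x \<and> j = y then 1 else 0)"


subsection \<open>Operator systems, irreducibility and the multiplier algebra\<close>

definition operator_system :: "(complex^'n^'n) set \<Rightarrow> bool" where
  "operator_system S \<longleftrightarrow> cmat.subspace S \<and> mat 1 \<in> S \<and> (\<forall>s\<in>S. cadjoint s \<in> S)"

definition reduces :: "(complex^'n) set \<Rightarrow> (complex^'n^'n) set \<Rightarrow> bool" where
  "reduces L S \<longleftrightarrow>
     vec.subspace L \<and> (\<forall>s\<in>S. \<forall>v\<in>L. s *v v \<in> L \<and> cadjoint s *v v \<in> L)"

text \<open>
  The operator norm of the \<open>m \<times> m\<close> operator matrix with entries \<open>s i j\<close> (\<open>i, j < m\<close>), restricted to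
  the subspace \<open>L\<^sup>m\<close> of the Hilbert space \<open>(\<complex>\<^sup>n)\<^sup>m\<close>.  Elements of \<open>(\<complex>\<^sup>n)\<^sup>m\<close> are functions \<open>v\<close> of
  which only the values at \<open>j < m\<close> matter.
\<close>

definition ampliation_norm ::
    "nat \<Rightarrow> (nat \<Rightarrow> nat \<Rightarrow> complex^'n^'n) \<Rightarrow> (complex^'n) set \<Rightarrow> real" where
  "ampliation_norm m s L =
     Sup {L2_set (\<lambda>i. norm (\<Sum>j<m. s i j *v v j)) {..<m} | v.
            (\<forall>j<m. v j \<in> L) \<and> L2_set (\<lambda>j. norm (v j)) {..<m} \<le> 1}"

definition restriction_completely_isometric ::
    "(complex^'n^'n) set \<Rightarrow> (complex^'n) set \<Rightarrow> bool" where
  "restriction_completely_isometric S L \<longleftrightarrow>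
     (\<forall>m s. (\<forall>i<m. \<forall>j<m. s i j \<in> S) \<longrightarrow> ampliation_norm m s L = ampliation_norm m s UNIV)"

definition acts_irreducibly :: "(complex^'n^'n) set \<Rightarrow> bool" where
  "acts_irreducibly S \<longleftrightarrow>
     \<not> (\<exists>L. L \<noteq> {0} \<and> L \<noteq> UNIV \<and> reduces L S \<and> restriction_completely_isometric S L)"

definition cstar_subalgebra :: "(complex^'n^'n) set \<Rightarrow> bool" where
  "cstar_subalgebra B \<longleftrightarrow>
     cmat.subspace B \<and> closed B \<and> (\<forall>a\<in>B. \<forall>b\<in>B. a ** b \<in> B) \<and> (\<forall>a\<in>B. cadjoint a \<in> B)"

definition generated_cstar :: "(complex^'n^'n) set \<Rightarrow> (complex^'n^'n) set" where
  "generated_cstar S = cstar_subalgebra hull S"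

definition multiplier_algebra :: "(complex^'n^'n) set \<Rightarrow> (complex^'n^'n) set" where
  "multiplier_algebra S =
     {a \<in> generated_cstar S. (\<forall>s\<in>S. a ** s \<in> S) \<and> (\<forall>s\<in>S. cadjoint a ** s \<in> S)}"


subsection \<open>Graphs\<close>

text \<open>A simple undirected graph with vertex set \<open>'n\<close> is given by its adjacency relation.\<close>

definition simple_graph :: "('n \<Rightarrow> 'n \<Rightarrow> bool) \<Rightarrow> bool" where
  "simple_graph E \<longleftrightarrow> symp E \<and> irreflp E"

definition adj_or_eq :: "('n \<Rightarrow> 'n \<Rightarrow> bool) \<Rightarrow> 'n \<Rightarrow> 'n \<Rightarrow> bool" where
  "adj_or_eq E x y \<longleftrightarrow> x = y \<or> E x y"

definition graph_operator_system :: "('n \<Rightarrow> 'n \<Rightarrow> bool) \<Rightarrow> (complex^'n^'n) set" where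
  "graph_operator_system E = cmat.span {matrix_unit x y | x y. adj_or_eq E x y}"

definition closed_nbhd :: "('n \<Rightarrow> 'n \<Rightarrow> bool) \<Rightarrow> 'n \<Rightarrow> 'n set" where
  "closed_nbhd E x = {z. adj_or_eq E x z}"

definition true_twins :: "('n \<Rightarrow> 'n \<Rightarrow> bool) \<Rightarrow> ('n \<times> 'n) set" where
  "true_twins E = {(x, y). closed_nbhd E x = closed_nbhd E y}"

lemma equiv_true_twins: "equiv UNIV (true_twins E)"
  by (auto simp: true_twins_def equiv_def refl_on_def sym_def trans_def)

definition true_twin_classes :: "('n \<Rightarrow> 'n \<Rightarrow> bool) \<Rightarrow> 'n set set" where
  "true_twin_classes E = UNIV // true_twins E"

lemma partition_on_true_twin_classes: "partition_on UNIV (true_twin_classes E)"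
  unfolding true_twin_classes_def by (rule partition_on_quotient[OF equiv_true_twins])


subsection \<open>Block-diagonal direct sums of full matrix algebras\<close>

definition full_block :: "'n set \<Rightarrow> (complex^'n^'n) set" where
  "full_block C = cmat.span {matrix_unit x y | x y. x \<in> C \<and> y \<in> C}"

text \<open>
  For a partition \<open>P\<close> of the index set into blocks, this is the block-diagonal algebra, the direct sum
  of the full matrix algebras of the blocks; by the lemmas below the sum over \<open>P\<close> is direct, the summands annihilate
  each other, and the sizes add up to \<open>n\<close>.
\<close>

definition block_direct_sum :: "'n set set \<Rightarrow> (complex^'n^'n) set" where
  "block_direct_sum P = {(\<Sum>C\<in>P. a C) | a. \<forall>C\<in>P. a C \<in> full_block C}"

lemma full_block_supported:
  assumes "A \<in> full_block C" "x \<notin> C \<or> y \<notin> C"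
  shows "A $ x $ y = 0"
proof -
  have "cmat.subspace {A. A $ x $ y = 0}"
    by (auto simp: cmat.subspace_def cscale_def)
  moreover have "{matrix_unit x y | x y. x \<in> C \<and> y \<in> C} \<subseteq> {A. A $ x $ y = 0}"
    using assms(2) by (auto simp: matrix_unit_def)
  ultimately show ?thesis
    using assms(1) cmat.span_minimal unfolding full_block_def by blast
qed

lemma block_sum_entry:
  fixes P :: "'n::finite set set"
  assumes "partition_on UNIV P" "\<forall>C\<in>P. a C \<in> full_block C" "D \<in> P" "x \<in> D" "y \<in> D"
  shows "(\<Sum>C\<in>P. a C) $ x $ y = a D $ x $ y"
proof -
  have "a C $ x $ y = 0" if "C \<in> P" "C \<noteq> D" for C
    using that assms by (metis disjoint_iff disjointD full_block_supported partition_onD2)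
  then have "(\<Sum>C\<in>P. a C $ x $ y) = (\<Sum>C\<in>P. if C = D then a D $ x $ y else 0)"
    by (intro sum.cong) auto
  then show ?thesis
    using assms(3) by simp
qed

lemma block_sum_direct:
  fixes P :: "'n::finite set set"
  assumes "partition_on UNIV P" "\<forall>C\<in>P. a C \<in> full_block C" "\<forall>C\<in>P. b C \<in> full_block C"
    and "(\<Sum>C\<in>P. a C) = (\<Sum>C\<in>P. b C)" "D \<in> P"
  shows "a D = b D"
proof -
  have "a D $ x $ y = b D $ x $ y" for x y
  proof (cases "x \<in> D \<and> y \<in> D")
    case True
    then show ?thesis
      using assms block_sum_entry by metis
  next
    case False
    then have "a D $ x $ y = 0" "b D $ x $ y = 0"
      using assms full_block_supported by blast+
    then show ?thesis by simp
  qed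
  then show ?thesis by (simp add: vec_eq_iff)
qed

lemma full_blocks_annihilate:
  assumes "A \<in> full_block C" "B \<in> full_block D" "C \<inter> D = {}"
  shows "A ** B = 0"
proof -
  have "A $ i $ k * B $ k $ j = 0" for i j k
    using assms full_block_supported by (metis disjoint_iff mult_eq_0_iff)
  then show ?thesis
    unfolding vec_eq_iff matrix_matrix_mult_def by (auto intro!: sum.neutral simp del: mult_eq_0_iff)
qed

lemma sum_card_blocks:
  assumes "partition_on (UNIV :: 'n::finite set) P"
  shows "(\<Sum>C\<in>P. card C) = CARD('n)"
  using assms card_Union_disjoint[of P]
  by (simp add: partition_on_def disjoint_def pairwise_def disjnt_def)

end

theory Submission
  imports Defs
begin

text \<open>
  Spans of matrix units are the spaces of matrices with prescribed support, so everything is read off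
  the supports. If \<open>a\<close> multiplies \<open>S\<^sub>G\<close> into itself and \<open>a\<^sub>x\<^sub>y \<noteq> 0\<close>, then multiplying by the unit at
  \<open>(y, z)\<close> shows that \<open>x\<close> is adjacent or equal to every \<open>z\<close> in the closed neighbourhood of \<open>y\<close>;
  the adjoint of \<open>a\<close> gives the reverse inclusion. Conversely, if the multiplier algebra is block
  diagonal, it contains the diagonal units, so \<open>S\<close> is closed under cutting down a matrix to a single
  entry and is therefore spanned by the matrix units it contains.
\<close>

lemma matrix_unit_nth: "matrix_unit x y $ i $ j = (if i = x \<and> j = y then 1 else 0)"
  by (simp add: matrix_unit_def)

lemma cscale_nth: "cscale c A $ i $ j = c * A $ i $ j"
  by (simp add: cscale_def)

lemma cadjoint_nth: "cadjoint A $ i $ j = cnj (A $ j $ i)"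
  by (simp add: cadjoint_def)

lemma matrix_mult_nth: "(A ** B) $ i $ j = (\<Sum>k\<in>UNIV. A $ i $ k * B $ k $ j)"
  by (simp add: matrix_matrix_mult_def)

lemma cadjoint_cadjoint [simp]: "cadjoint (cadjoint A) = A"
  by (simp add: vec_eq_iff cadjoint_nth)

lemma cadjoint_mult: "cadjoint (A ** B) = cadjoint B ** cadjoint A"
  by (simp add: vec_eq_iff cadjoint_nth matrix_mult_nth mult.commute)

lemma cadjoint_matrix_unit: "cadjoint (matrix_unit x y) = matrix_unit y x"
  by (auto simp: vec_eq_iff cadjoint_nth matrix_unit_nth)

lemma mult_matrix_unit_nth:
  "(A ** matrix_unit x y) $ i $ j = (if j = y then A $ i $ x else 0)"
proof -
  have "(A ** matrix_unit x y) $ i $ j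
      = (\<Sum>k\<in>UNIV. if k = x then (if j = y then A $ i $ x else 0) else 0)"
    unfolding matrix_mult_nth by (intro sum.cong) (auto simp: matrix_unit_nth)
  then show ?thesis by simp
qed

lemma matrix_unit_mult_nth:
  "(matrix_unit x y ** A) $ i $ j = (if i = x then A $ y $ j else 0)"
proof -
  have "(matrix_unit x y ** A) $ i $ j
      = (\<Sum>k\<in>UNIV. if k = y then (if i = x then A $ y $ j else 0) else 0)"
    unfolding matrix_mult_nth by (intro sum.cong) (auto simp: matrix_unit_nth)
  then show ?thesis by simp
qed

lemma matrix_eq_sum_matrix_units:
  "A = (\<Sum>x\<in>UNIV. \<Sum>y\<in>UNIV. cscale (A $ x $ y) (matrix_unit x y))"
proof -
  have "(\<Sum>x\<in>UNIV. \<Sum>y\<in>UNIV. cscale (A $ x $ y) (matrix_unit x y)) $ i $ j = A $ i $ j" for i j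
  proof -
    have "(\<Sum>x\<in>UNIV. \<Sum>y\<in>UNIV. cscale (A $ x $ y) (matrix_unit x y)) $ i $ j
        = (\<Sum>x\<in>UNIV. \<Sum>y\<in>UNIV. if y = j then (if x = i then A $ i $ j else 0) else 0)"
      unfolding sum_component by (intro sum.cong refl) (auto simp: cscale_nth matrix_unit_nth)
    also have "\<dots> = A $ i $ j" by simp
    finally show ?thesis .
  qed
  then show ?thesis by (simp add: vec_eq_iff)
qed

text \<open>Matrices supported on \<open>R\<close> form a subspace containing the listed units.
  Conversely, expanding such a matrix in units, each pair outside \<open>R\<close> has coefficient
  zero. Leaving \<open>R\<close> arbitrary serves graph operator systems and full blocks
  alike.\<close>

lemma span_matrix_units:
  fixes R :: "'n::finite \<Rightarrow> 'n \<Rightarrow> bool"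
  shows "cmat.span {matrix_unit x y | x y. R x y} = {A. \<forall>x y. A $ x $ y \<noteq> 0 \<longrightarrow> R x y}"
    (is "cmat.span ?U = ?A")
proof
  have "cmat.subspace ?A"
    \<comment> \<open>For closure under addition: a nonzero sum of two entries has a nonzero
      summand, which supplies \<open>R x y\<close>.\<close>
    by (rule cmat.subspaceI) (simp_all add: cscale_nth, metis add_0)
  then show "cmat.span ?U \<subseteq> ?A"
    by (intro cmat.span_minimal) (auto simp: matrix_unit_nth split: if_splits)
next
  show "?A \<subseteq> cmat.span ?U"
  proof
    fix A assume A: "A \<in> ?A"
    have "cscale (A $ x $ y) (matrix_unit x y) \<in> cmat.span ?U" for x y
    proof (cases "A $ x $ y = 0")
      case True
      then show ?thesis by (simp add: cmat.span_zero)
    next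
      case False
      with A have "matrix_unit x y \<in> ?U" by blast
      then show ?thesis by (intro cmat.span_scale cmat.span_base)
    qed
    then have "(\<Sum>x\<in>UNIV. \<Sum>y\<in>UNIV. cscale (A $ x $ y) (matrix_unit x y)) \<in> cmat.span ?U"
      by (intro cmat.span_sum)
    then show "A \<in> cmat.span ?U"
      using matrix_eq_sum_matrix_units[of A] by simp
  qed
qed

lemma mem_graph_operator_system_iff:
  fixes G :: "'n::finite \<Rightarrow> 'n \<Rightarrow> bool"
  shows "A \<in> graph_operator_system G \<longleftrightarrow> (\<forall>x y. A $ x $ y \<noteq> 0 \<longrightarrow> adj_or_eq G x y)"
  by (simp add: graph_operator_system_def span_matrix_units)

lemma mem_full_block_iff:
  fixes C :: "'n::finite set"
  shows "A \<in> full_block C \<longleftrightarrow> (\<forall>x y. A $ x $ y \<noteq> 0 \<longrightarrow> x \<in> C \<and> y \<in> C)"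
  by (simp add: full_block_def span_matrix_units)

lemma mem_block_direct_sum_iff:
  fixes P :: "'n::finite set set"
  assumes P: "partition_on UNIV P"
  shows "A \<in> block_direct_sum P \<longleftrightarrow> (\<forall>x y. A $ x $ y \<noteq> 0 \<longrightarrow> (\<exists>C\<in>P. x \<in> C \<and> y \<in> C))"
proof
  assume "A \<in> block_direct_sum P"
  then obtain a where A: "A = (\<Sum>C\<in>P. a C)" and a: "\<forall>C\<in>P. a C \<in> full_block C"
    by (auto simp: block_direct_sum_def)
  show "\<forall>x y. A $ x $ y \<noteq> 0 \<longrightarrow> (\<exists>C\<in>P. x \<in> C \<and> y \<in> C)"
  proof (intro allI impI)
    fix x y assume "A $ x $ y \<noteq> 0"
    then have "(\<Sum>C\<in>P. a C $ x $ y) \<noteq> 0" by (simp add: A)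
    then obtain C where "C \<in> P" "a C $ x $ y \<noteq> 0" by (meson sum.neutral)
    with a show "\<exists>C\<in>P. x \<in> C \<and> y \<in> C"
      by (auto simp: mem_full_block_iff)
  qed
next
  assume A: "\<forall>x y. A $ x $ y \<noteq> 0 \<longrightarrow> (\<exists>C\<in>P. x \<in> C \<and> y \<in> C)"
  \<comment> \<open>The only possible decomposition: the component in block \<open>C\<close> is
    \<open>A\<close> cut down to the square C x C.\<close>
  define a :: "'n set \<Rightarrow> complex^'n^'n"
    where "a C = (\<chi> x y. if x \<in> C \<and> y \<in> C then A $ x $ y else 0)" for C
  have a: "\<forall>C\<in>P. a C \<in> full_block C"
    by (simp add: mem_full_block_iff a_def)
  have "(\<Sum>C\<in>P. a C) $ x $ y = A $ x $ y" for x y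
  proof (cases "\<exists>C\<in>P. x \<in> C \<and> y \<in> C")
    case True
    then obtain C where "C \<in> P" "x \<in> C" "y \<in> C" by blast
    then show ?thesis
      using block_sum_entry[OF P a] by (simp add: a_def)
  next
    case False
    then have "a C $ x $ y = 0" if "C \<in> P" for C
      using that by (auto simp: a_def)
    then have "(\<Sum>C\<in>P. a C) $ x $ y = 0" by simp
    moreover have "A $ x $ y = 0" using False A by blast
    ultimately show ?thesis by simp
  qed
  then have "A = (\<Sum>C\<in>P. a C)" by (simp add: vec_eq_iff)
  with a show "A \<in> block_direct_sum P"
    by (auto simp: block_direct_sum_def)
qed

lemma mem_block_direct_sum_true_twin_classes_iff:
  fixes G :: "'n::finite \<Rightarrow> 'n \<Rightarrow> bool"
  shows "A \<in> block_direct_sum (true_twin_classes G) \<longleftrightarrow>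
    (\<forall>x y. A $ x $ y \<noteq> 0 \<longrightarrow> closed_nbhd G x = closed_nbhd G y)"
proof -
  have "(\<exists>C\<in>true_twin_classes G. x \<in> C \<and> y \<in> C) \<longleftrightarrow> closed_nbhd G x = closed_nbhd G y" for x y
    by (auto simp: true_twin_classes_def quotient_def true_twins_def)
  then show ?thesis
    by (simp add: mem_block_direct_sum_iff[OF partition_on_true_twin_classes])
qed

lemma generated_cstar_superset: "S \<subseteq> generated_cstar S"
  unfolding generated_cstar_def by (rule hull_subset)

text \<open>The entry of \<open>a ** matrix_unit y z\<close> at (x, z) is that of \<open>a\<close>
  at (x, y). Multiplication by \<open>a\<close> alone yields one inclusion; the other comes from
  applying the lemma to the adjoint, where x and y trade places.\<close>

lemma closed_nbhd_mono_if_left_multiplier: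
  fixes G :: "'n::finite \<Rightarrow> 'n \<Rightarrow> bool"
  assumes "\<forall>s\<in>graph_operator_system G. a ** s \<in> graph_operator_system G" and "a $ x $ y \<noteq> 0"
  shows "closed_nbhd G y \<subseteq> closed_nbhd G x"
proof
  fix z assume "z \<in> closed_nbhd G y"
  then have "matrix_unit y z \<in> graph_operator_system G"
    by (simp add: mem_graph_operator_system_iff matrix_unit_nth closed_nbhd_def)
  with assms(1) have "a ** matrix_unit y z \<in> graph_operator_system G" by blast
  with assms(2) show "z \<in> closed_nbhd G x"
    by (simp add: mem_graph_operator_system_iff mult_matrix_unit_nth closed_nbhd_def)
qed

text \<open>A nonzero entry of the product at (x, z) passes through some y with \<open>a\<close>
  nonzero at (x, y) and \<open>s\<close> nonzero at (y, z). Then z is a closed neighbour of y, hence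
  of its twin x.\<close>

lemma left_multiplier_if_supported_on_true_twins:
  fixes G :: "'n::finite \<Rightarrow> 'n \<Rightarrow> bool"
  assumes a: "\<forall>x y. a $ x $ y \<noteq> 0 \<longrightarrow> closed_nbhd G x = closed_nbhd G y"
    and s: "s \<in> graph_operator_system G"
  shows "a ** s \<in> graph_operator_system G"
  unfolding mem_graph_operator_system_iff
proof (intro allI impI)
  fix x z assume "(a ** s) $ x $ z \<noteq> 0"
  then obtain y where "a $ x $ y * s $ y $ z \<noteq> 0"
    unfolding matrix_mult_nth by (meson sum.neutral)
  then have "closed_nbhd G x = closed_nbhd G y" "z \<in> closed_nbhd G y"
    using a s by (auto simp: mem_graph_operator_system_iff closed_nbhd_def)
  then show "adj_or_eq G x z" by (auto simp: closed_nbhd_def)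
qed

theorem multiplier_algebra_graph_operator_system:
  fixes G :: "'n::finite \<Rightarrow> 'n \<Rightarrow> bool"
  shows "multiplier_algebra (graph_operator_system G) = block_direct_sum (true_twin_classes G)"
proof (intro set_eqI iffI)
  fix a assume "a \<in> multiplier_algebra (graph_operator_system G)"
  then have a: "\<forall>s\<in>graph_operator_system G. a ** s \<in> graph_operator_system G"
    and a': "\<forall>s\<in>graph_operator_system G. cadjoint a ** s \<in> graph_operator_system G"
    by (auto simp: multiplier_algebra_def)
  show "a \<in> block_direct_sum (true_twin_classes G)"
    unfolding mem_block_direct_sum_true_twin_classes_iff
    using closed_nbhd_mono_if_left_multiplier[OF a] closed_nbhd_mono_if_left_multiplier[OF a']
    by (simp add: cadjoint_nth subset_antisym)
next
  fix a assume "a \<in> block_direct_sum (true_twin_classes G)"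
  then have a: "\<forall>x y. a $ x $ y \<noteq> 0 \<longrightarrow> closed_nbhd G x = closed_nbhd G y"
    by (simp add: mem_block_direct_sum_true_twin_classes_iff)
  then have a': "\<forall>x y. cadjoint a $ x $ y \<noteq> 0 \<longrightarrow> closed_nbhd G x = closed_nbhd G y"
    by (auto simp: cadjoint_nth)
  \<comment> \<open>Since \<open>a = a ** mat 1\<close>, the identity puts \<open>a\<close> into the
    operator system itself, and so into the C*-algebra it generates, as the multiplier algebra
    demands.\<close>
  have "mat 1 \<in> graph_operator_system G"
    by (simp add: mem_graph_operator_system_iff mat_def adj_or_eq_def)
  then have "a \<in> graph_operator_system G"
    using left_multiplier_if_supported_on_true_twins[OF a, of "mat 1"] by simp
  then show "a \<in> multiplier_algebra (graph_operator_system G)"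
    unfolding multiplier_algebra_def
    using generated_cstar_superset left_multiplier_if_supported_on_true_twins[OF a]
      left_multiplier_if_supported_on_true_twins[OF a'] by blast
qed

theorem graph_operator_system_if_diagonal_multipliers:
  fixes S :: "(complex^'n^'n) set"
  assumes S: "operator_system S" and diag: "\<And>x. matrix_unit x x \<in> multiplier_algebra S"
  shows "\<exists>H. simple_graph H \<and> S = graph_operator_system H"
proof -
  have sub: "cmat.subspace S" and one: "mat 1 \<in> S" and adj: "\<And>s. s \<in> S \<Longrightarrow> cadjoint s \<in> S"
    using S by (auto simp: operator_system_def)
  have left: "matrix_unit x x ** s \<in> S" if "s \<in> S" for x s
    using diag that by (auto simp: multiplier_algebra_def)
  \<comment> \<open>Multipliers act from the left only; because \<open>S\<close> is selfadjoint and
    diagonal units equal their adjoints, they also act from the right.\<close>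
  have right: "s ** matrix_unit y y \<in> S" if "s \<in> S" for y s
  proof -
    have "cadjoint (matrix_unit y y ** cadjoint s) \<in> S"
      using that by (intro adj left)
    then show ?thesis by (simp add: cadjoint_mult cadjoint_matrix_unit)
  qed
  have unit: "matrix_unit x y \<in> S" if "s \<in> S" "s $ x $ y \<noteq> 0" for s x y
  proof -
    \<comment> \<open>Cutting \<open>s\<close> to row x and column y leaves a multiple of
      \<open>matrix_unit x y\<close> by the entry of \<open>s\<close> there; dividing by that entry
      leaves the unit.\<close>
    have "cscale (inverse (s $ x $ y)) (matrix_unit x x ** (s ** matrix_unit y y)) \<in> S"
      using that(1) by (intro cmat.subspace_scale[OF sub] left right)
    also have "cscale (inverse (s $ x $ y)) (matrix_unit x x ** (s ** matrix_unit y y))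
        = matrix_unit x y"
      using that(2)
      by (simp add: vec_eq_iff cscale_nth matrix_unit_mult_nth mult_matrix_unit_nth matrix_unit_nth)
    finally show ?thesis .
  qed
  \<comment> \<open>Loops are excluded to make the graph simple; its symmetry comes from the adjoint
    exchanging the units at (x, y) and (y, x).\<close>
  define H where "H x y \<longleftrightarrow> x \<noteq> y \<and> matrix_unit x y \<in> S" for x y
  have "simple_graph H"
    unfolding simple_graph_def H_def
    by (auto intro!: sympI irreflpI dest: adj simp: cadjoint_matrix_unit)
  \<comment> \<open>On the diagonal the left side always holds; the right side does too, since the
    identity has nonzero diagonal entries and \<open>unit\<close> applies to it.\<close>
  moreover have H: "adj_or_eq H x y \<longleftrightarrow> matrix_unit x y \<in> S" for x y
    using unit[OF one, of x x] by (auto simp: adj_or_eq_def H_def mat_def)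
  have "S = graph_operator_system H"
  proof
    show "S \<subseteq> graph_operator_system H"
      by (auto simp: mem_graph_operator_system_iff H intro: unit)
    show "graph_operator_system H \<subseteq> S"
      unfolding graph_operator_system_def by (rule cmat.span_minimal[OF _ sub]) (auto simp: H)
  qed
  ultimately show ?thesis by blast
qed

theorem proposition2p4:
  shows "(\<forall>G :: 'n::finite \<Rightarrow> 'n \<Rightarrow> bool. simple_graph G \<longrightarrow>
            multiplier_algebra (graph_operator_system G) = block_direct_sum (true_twin_classes G))
       \<and> (\<forall>(S :: (complex^'n^'n) set) P.
            operator_system S \<and> acts_irreducibly S \<and> partition_on UNIV P
              \<and> multiplier_algebra S = block_direct_sum P \<longrightarrow>
            (\<exists>H. simple_graph H \<and> S = graph_operator_system H))"
proof (intro conjI allI impI)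
  fix G :: "'n \<Rightarrow> 'n \<Rightarrow> bool"
  show "multiplier_algebra (graph_operator_system G) = block_direct_sum (true_twin_classes G)"
    by (rule multiplier_algebra_graph_operator_system)
next
  fix S :: "(complex^'n^'n) set" and P
  assume *: "operator_system S \<and> acts_irreducibly S \<and> partition_on UNIV P
    \<and> multiplier_algebra S = block_direct_sum P"
  then have P: "partition_on UNIV P" by blast
  \<comment> \<open>The blocks cover the index set, so every x shares a block with itself.\<close>
  have "matrix_unit x x \<in> block_direct_sum P" for x
    using partition_onD1[OF P] by (auto simp: mem_block_direct_sum_iff[OF P] matrix_unit_nth)
  with * show "\<exists>H. simple_graph H \<and> S = graph_operator_system H"
    by (intro graph_operator_system_if_diagonal_multipliers) auto
qed

end
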